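(* Let $\varepsilon:=\inf\{r\in|\mathbb{I}^*|: r>1\}$. Then $\varepsilon$ is well-defined and $\varepsilon=2^{1/12}$.
   Context: Setting: a set $\mathbb{S}$ (of "sounds"), a binary relation $*$ on $\mathbb{S}$ ($x*y$: $x$ is lower-pitched than $y$), a relation $\cong$ on intervals, a binary relation $\simeq$ on $\mathbb{S}$ ("equitonal") and a set $\mathbb{I}^*$ of "harmonic" intervals, satisfying the axioms below. (The paper's further axioms on loudness and colour concern other notions not occurring in the claim.) Pitch. Write $x\sim y$ iff neither $x*y$ nor $y*x$. (1) $\neg(x*x)$ for all $x$. (2) $*$ is transitive. (3) There are $x,y$ with $x*y$ or $y*x$. (4) If $x*y$, then no $z$ satisfies both $x\sim z$ and $y\sim z$. (5) For every $x$ there are $a,b$ with $a*x$ and $x*b$; and if $x*y$ there is $a$ with $x*a$ and $a*y$. Then $\sim$ is an equivalence relation; $\tilde x$ is the class of $x$. Intervals. $[a,b]:=(\tilde a,\tilde b)$, $[a,b]^{-1}:=[b,a]$, $\mathbb{I}:=(\mathbb{S}/\sim)\times(\mathbb{S}/\sim)$, and $\cong$ is a binary relation on $\mathbb{I}$. (6) $\cong$ is reflexive. (7) $\cong$ is transitive. (8) For all $x,y,a$ there is $b$ with $[x,y]\cong[a,b]$, and any $b'$ with $[x,y]\cong[a,b']$ satisfies $b\sim b'$. (9) If $a*b$: $[a,b]\cong[c,d]$ implies $c*d$; and $[a,b]\cong[c,d]$ iff $[b,a]\cong[d,c]$. (10) If $a*b$ and $b*c$: $[a,b]\cong[a',b']$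 and $[b,c]\cong[b',c']$ imply $[a,c]\cong[a',c']$; and $[a,b]\cong[a',b']^{-1}$ and $[b,c]\cong[b',c']^{-1}$ imply $[a,c]\cong[a',c']^{-1}$. (11) (Dedekind) If $\mathbb{S}$ is partitioned into two nonempty sets $P,Q$ such that no sound of $Q$ is lower-pitched than a sound of $P$, there is $\theta\in\mathbb{S}$ such that every $s*\theta$ lies in $P$ and every $s$ with $\theta*s$ lies in $Q$. Tonality. (15) $x\sim y$ implies $x\simeq y$; and $x\simeq z$, $y\simeq z$ imply $x\simeq y$. $\hat s$ is the $\simeq$-class of $s$. A sound minimal with respect to $*$ in $\{x: x\simeq s,\ s*x\}$, when it exists, is denoted $s^*$ (unique up to $\sim$), and $[s,s^*]$ is called an octave interval. An octave interval exists. (16) Every interval congruent to an octave interval is an octave interval. Measure. Under these axioms all octave intervals are congruent and there is a unique $|\cdot|:\mathbb{I}\to\mathbb{R}^+$ such that octave intervals have measure $2$, $|[a,b]|>1$ iff $a*b$, $|[a,b]|=1$ iff $a\sim b$, $|[a,b]|<1$ iff $b*a$, $|[a,b]|=|[c,d]|$ iff $[a,b]\cong[c,d]$, and $|[a,c]|=|[a,b]|\cdot|[b,c]|$; it is onto. Harmony. $|\mathbb{I}^*|=\{|I|:I\in\mathbb{I}^*\}$. (17) If $a*b$, $[a,b]\cong[c,d]$ and $[a,b]$ is harmonic, then $[c,d]$ is harmonic; and if $[a,b]$ is harmonic with $a\not\sim b$, then $[b,a]$ is harmonic. (18) If $r,r'\in|\mathbb{I}^*|$, $r>1$ and $r'\neq1$,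 then $rr'\in|\mathbb{I}^*|$. (19) There is $\alpha>1$ such that no $\beta\in|\mathbb{I}^*|$ satisfies $1<\beta<\alpha$. A scale is a triple $(\hat s,(r_i)_{i=1}^m,(r'_i)_{i=1}^n)$ with $s\in\mathbb{S}$, $r_i\in|\mathbb{I}^*|$, $r_i>1$, $r'_i\in|\mathbb{I}^*|$, $r'_i<1$, $\prod r_i=2$, $\prod r'_i=1/2$; its tonic is $\hat s$. It is heptatonic if $m=n=7$, and compatible if $m=n$ and $r'_i=r_{n-i+1}^{-1}$ for all $i$. Its ascendent (descendent) mode is $\{r_i\}$ ($\{r'_i\}$); a mode is maximally even if it is contained in $\{\varepsilon^k,\varepsilon^{k+1}\}$ for some integer $k$. Let $s_0=s'_0=s$, $|[s_{i-1},s_i]|=r_i$, $|[s'_{j-1},s'_j]|=r'_j$; the ascendent components set is $\{\hat s_i:0\le i\le m\}$. The ascendent (descendent) module has the sensible if $r_m=\varepsilon$ ($r_n'^{-1}=\varepsilon$). A tetrachord is a triple $(r_{k-1},r_k,r_{k+1})$ with $1<k<m$, with components $\hat s_{k-2},\hat s_{k-1},\hat s_k,\hat s_{k+1}$, or a triple $(r'_{l-1},r'_l,r'_{l+1})$ with $1<l<n$, with components $\hat s'_{l-2},\dots,\hat s'_{l+1}$; two tetrachords are disjoint if their sets of components have no common element except possibly $\hat s$. A triad is $(x,y,z)$ with $x*y$, $y*z$ and $[x,y],[y,z]$ harmonic; it is major if $|[x,y]|=\varepsilon\,|[y,z]|$ and $[x,z]$ is harmonic of measure $\varepsilon\cdot2^{1/2}$.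 A triad $(x,y,z)$ is scale-based on the tonic of a compatible scale if $\hat s,\hat u,\hat v$ all lie in the ascendent components set, where $|[s,u]|=|[x,y]|$ and $|[u,v]|=|[y,z]|$. (20) (Major Scale Axiom) There exists a heptatonic compatible scale with maximally even mode, whose ascendent module has the sensible and whose descendent module does not, having two disjoint and equal tetrachords, and such that a major triad is scale-based on its tonic. (Here $\varepsilon$ is as in the claim; "well-defined" means that the set whose infimum is taken is nonempty and bounded below.) *)

theory Defs
  imports Complex_Main
begin

text \<open>The set of sounds is the whole type \<open>'a\<close>. Intervals are pairs of pitch classes, so
  they have type \<open>'a set \<times> 'a set\<close>; only the pairs in \<open>intervals\<close> below are
  genuine intervals, and relations and functions on intervals are constrained only there.\<close>

locale pitch_relation =
  fixes lower :: "'a \<Rightarrow> 'a \<Rightarrow> bool"  (infix "\<prec>" 50)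
begin

definition unison :: "'a \<Rightarrow> 'a \<Rightarrow> bool"  (infix "\<sim>" 50) where
  "x \<sim> y \<longleftrightarrow> \<not> x \<prec> y \<and> \<not> y \<prec> x"

definition pitch_class :: "'a \<Rightarrow> 'a set" where
  "pitch_class x = {(u, v). u \<sim> v} `` {x}"

definition ivl :: "'a \<Rightarrow> 'a \<Rightarrow> 'a set \<times> 'a set" where
  "ivl a b = (pitch_class a, pitch_class b)"

definition intervals :: "('a set \<times> 'a set) set" where
  "intervals = (UNIV // {(u, v). u \<sim> v}) \<times> (UNIV // {(u, v). u \<sim> v})"

end

locale pitch = pitch_relation +
  assumes lower_irrefl: "\<not> x \<prec> x"
    and lower_trans: "x \<prec> y \<Longrightarrow> y \<prec> z \<Longrightarrow> x \<prec> z"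
    and lower_nontrivial: "\<exists>x y. x \<prec> y \<or> y \<prec> x"
    and lower_no_common_unison: "x \<prec> y \<Longrightarrow> \<not> (\<exists>z. x \<sim> z \<and> y \<sim> z)"
    and lower_unbounded: "\<exists>a b. a \<prec> x \<and> x \<prec> b"
    and lower_dense: "x \<prec> y \<Longrightarrow> \<exists>a. x \<prec> a \<and> a \<prec> y"

text \<open>The inverse \<open>[a', b']\<inverse>\<close> of an interval is written out as \<open>ivl b' a'\<close>.\<close>

locale pitch_congruence = pitch +
  fixes congr :: "'a set \<times> 'a set \<Rightarrow> 'a set \<times> 'a set \<Rightarrow> bool"  (infix "\<cong>" 50)
  assumes congr_refl: "reflp_on intervals (\<cong>)"
    and congr_trans: "transp_on intervals (\<cong>)"
    and congr_transport: "\<exists>b. ivl x y \<cong> ivl a b"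
    and congr_transport_unique: "ivl x y \<cong> ivl a b \<Longrightarrow> ivl x y \<cong> ivl a b' \<Longrightarrow> b \<sim> b'"
    and congr_lower: "a \<prec> b \<Longrightarrow> ivl a b \<cong> ivl c d \<Longrightarrow> c \<prec> d"
    and congr_inverse: "a \<prec> b \<Longrightarrow> ivl a b \<cong> ivl c d \<longleftrightarrow> ivl b a \<cong> ivl d c"
    and congr_compose: "a \<prec> b \<Longrightarrow> b \<prec> c \<Longrightarrow>
      ivl a b \<cong> ivl a' b' \<Longrightarrow> ivl b c \<cong> ivl b' c' \<Longrightarrow> ivl a c \<cong> ivl a' c'"
    and congr_compose_inverse: "a \<prec> b \<Longrightarrow> b \<prec> c \<Longrightarrow>
      ivl a b \<cong> ivl b' a' \<Longrightarrow> ivl b c \<cong> ivl c' b' \<Longrightarrow> ivl a c \<cong> ivl c' a'"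
    and dedekind: "P \<union> Q = UNIV \<Longrightarrow> P \<inter> Q = {} \<Longrightarrow> P \<noteq> {} \<Longrightarrow> Q \<noteq> {} \<Longrightarrow>
      \<forall>q\<in>Q. \<forall>p\<in>P. \<not> q \<prec> p \<Longrightarrow>
      \<exists>\<theta>. (\<forall>s. s \<prec> \<theta> \<longrightarrow> s \<in> P) \<and> (\<forall>s. \<theta> \<prec> s \<longrightarrow> s \<in> Q)"

locale equitonality = pitch_congruence +
  fixes equitonal :: "'a \<Rightarrow> 'a \<Rightarrow> bool"  (infix "\<simeq>" 50)
begin

definition tone :: "'a \<Rightarrow> 'a set" where
  "tone s = {x. x \<simeq> s}"

text \<open>\<open>is_octave_above s t\<close> says that \<open>t\<close> is a possible value of \<open>s\<^sup>*\<close>, which is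
  determined only up to unison.\<close>

definition is_octave_above :: "'a \<Rightarrow> 'a \<Rightarrow> bool" where
  "is_octave_above s t \<longleftrightarrow>
     t \<in> {x. x \<simeq> s \<and> s \<prec> x} \<and> (\<forall>x\<in>{x. x \<simeq> s \<and> s \<prec> x}. \<not> x \<prec> t)"

definition octaves :: "('a set \<times> 'a set) set" where
  "octaves = {ivl s t |s t. is_octave_above s t}"

end

locale tonality = equitonality +
  assumes unison_equitonal: "x \<sim> y \<Longrightarrow> x \<simeq> y"
    and equitonal_euclid: "x \<simeq> z \<Longrightarrow> y \<simeq> z \<Longrightarrow> x \<simeq> y"
    and octave_exists: "octaves \<noteq> {}"
    and octave_congr: "I \<in> octaves \<Longrightarrow> J \<in> intervals \<Longrightarrow> J \<cong> I \<Longrightarrow> J \<in> octaves"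
begin

definition is_measure :: "('a set \<times> 'a set \<Rightarrow> real) \<Rightarrow> bool" where
  "is_measure \<mu> \<longleftrightarrow>
     (\<forall>I\<in>intervals. \<mu> I > 0) \<and>
     (\<forall>I\<in>octaves. \<mu> I = 2) \<and>
     (\<forall>a b. \<mu> (ivl a b) > 1 \<longleftrightarrow> a \<prec> b) \<and>
     (\<forall>a b. \<mu> (ivl a b) = 1 \<longleftrightarrow> a \<sim> b) \<and>
     (\<forall>a b. \<mu> (ivl a b) < 1 \<longleftrightarrow> b \<prec> a) \<and>
     (\<forall>a b c d. \<mu> (ivl a b) = \<mu> (ivl c d) \<longleftrightarrow> ivl a b \<cong> ivl c d) \<and>
     (\<forall>a b c. \<mu> (ivl a c) = \<mu> (ivl a b) * \<mu> (ivl b c))"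

text \<open>The axioms imply that a measure exists and is unique on \<open>intervals\<close>; the choice
  operator only fixes the irrelevant values at pairs that are not intervals.\<close>

definition msr :: "'a set \<times> 'a set \<Rightarrow> real" where
  "msr = (SOME \<mu>. is_measure \<mu>)"

end

locale harmonic_intervals = tonality +
  fixes harmonic :: "('a set \<times> 'a set) set"
begin

definition harmonic_measures :: "real set" where
  "harmonic_measures = msr ` harmonic"

definition epsilon :: real where
  "epsilon = Inf {r \<in> harmonic_measures. r > 1}"

text \<open>Finite sequences \<open>r\<^sub>1, \<dots>, r\<^sub>m\<close> are lists, so \<open>r\<^sub>i\<close> is \<open>rs ! (i - 1)\<close>.\<close>

definition is_scale :: "'a set \<times> real list \<times> real list \<Rightarrow> bool" where
  "is_scale = (\<lambda>(t, rs, rs').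
     (\<exists>s. t = tone s) \<and>
     (\<forall>r\<in>set rs. r \<in> harmonic_measures \<and> r > 1) \<and>
     (\<forall>r\<in>set rs'. r \<in> harmonic_measures \<and> r < 1) \<and>
     prod_list rs = 2 \<and> prod_list rs' = 1 / 2)"

definition heptatonic :: "'a set \<times> real list \<times> real list \<Rightarrow> bool" where
  "heptatonic = (\<lambda>(t, rs, rs'). length rs = 7 \<and> length rs' = 7)"

definition compatible :: "'a set \<times> real list \<times> real list \<Rightarrow> bool" where
  "compatible = (\<lambda>(t, rs, rs'). length rs = length rs' \<and>
     (\<forall>i\<in>{1..length rs'}. rs' ! (i - 1) = inverse (rs ! (length rs' - i + 1 - 1))))"

definition ascendent_mode :: "'a set \<times> real list \<times> real list \<Rightarrow> real set" where
  "ascendent_mode = (\<lambda>(t, rs, rs'). set rs)"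

definition maximally_even :: "real set \<Rightarrow> bool" where
  "maximally_even M \<longleftrightarrow> (\<exists>k::int. M \<subseteq> {epsilon powi k, epsilon powi (k + 1)})"

definition ascendent_sensible :: "'a set \<times> real list \<times> real list \<Rightarrow> bool" where
  "ascendent_sensible = (\<lambda>(t, rs, rs'). last rs = epsilon)"

definition descendent_sensible :: "'a set \<times> real list \<times> real list \<Rightarrow> bool" where
  "descendent_sensible = (\<lambda>(t, rs, rs'). inverse (last rs') = epsilon)"

text \<open>\<open>scale_note s rs i\<close> is \<open>s\<^sub>i\<close>, which is determined only up to unison. The notions based on
  it below take a representative \<open>s\<close> of the tonic as an argument.\<close>

primrec scale_note :: "'a \<Rightarrow> real list \<Rightarrow> nat \<Rightarrow> 'a" where
  "scale_note s rs 0 = s"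
| "scale_note s rs (Suc i) = (SOME x. msr (ivl (scale_note s rs i) x) = rs ! i)"

definition components :: "'a \<Rightarrow> real list \<Rightarrow> 'a set set" where
  "components s rs = {tone (scale_note s rs i) |i. i \<le> length rs}"

text \<open>A tetrachord is stored together with its set of components. The function is applied
  both to the ascendent and to the descendent steps of a scale.\<close>

definition tetrachords :: "'a \<Rightarrow> real list \<Rightarrow> ((real \<times> real \<times> real) \<times> 'a set set) set" where
  "tetrachords s rs =
     {((rs ! (k - 1 - 1), rs ! (k - 1), rs ! (k + 1 - 1)),
       {tone (scale_note s rs i) |i. k - 2 \<le> i \<and> i \<le> k + 1}) |k. 1 < k \<and> k < length rs}"

definition has_disjoint_equal_tetrachords :: "'a \<Rightarrow> real list \<Rightarrow> real list \<Rightarrow> bool" where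
  "has_disjoint_equal_tetrachords s rs rs' \<longleftrightarrow>
     (\<exists>T \<in> tetrachords s rs \<union> tetrachords s rs'. \<exists>U \<in> tetrachords s rs \<union> tetrachords s rs'.
        T \<noteq> U \<and> fst T = fst U \<and> snd T \<inter> snd U \<subseteq> {tone s})"

definition is_triad :: "'a \<times> 'a \<times> 'a \<Rightarrow> bool" where
  "is_triad = (\<lambda>(x, y, z). x \<prec> y \<and> y \<prec> z \<and> ivl x y \<in> harmonic \<and> ivl y z \<in> harmonic)"

definition major_triad :: "'a \<times> 'a \<times> 'a \<Rightarrow> bool" where
  "major_triad = (\<lambda>(x, y, z). is_triad (x, y, z) \<and>
     msr (ivl x y) = epsilon * msr (ivl y z) \<and>
     ivl x z \<in> harmonic \<and> msr (ivl x z) = epsilon * 2 powr (1 / 2))"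

definition based_on_tonic :: "'a \<Rightarrow> real list \<Rightarrow> 'a \<times> 'a \<times> 'a \<Rightarrow> bool" where
  "based_on_tonic s rs = (\<lambda>(x, y, z). \<exists>u v.
     msr (ivl s u) = msr (ivl x y) \<and> msr (ivl u v) = msr (ivl y z) \<and>
     {tone s, tone u, tone v} \<subseteq> components s rs)"

end

locale harmony = harmonic_intervals +
  assumes harmonic_subset: "harmonic \<subseteq> intervals"
    and harmonic_congr: "a \<prec> b \<Longrightarrow> ivl a b \<cong> ivl c d \<Longrightarrow> ivl a b \<in> harmonic \<Longrightarrow>
      ivl c d \<in> harmonic"
    and harmonic_inverse: "ivl a b \<in> harmonic \<Longrightarrow> \<not> a \<sim> b \<Longrightarrow> ivl b a \<in> harmonic"
    and harmonic_mult: "r \<in> harmonic_measures \<Longrightarrow> r' \<in> harmonic_measures \<Longrightarrow>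
      r > 1 \<Longrightarrow> r' \<noteq> 1 \<Longrightarrow> r * r' \<in> harmonic_measures"
    and harmonic_gap: "\<exists>\<alpha>>1. \<not> (\<exists>\<beta>\<in>harmonic_measures. 1 < \<beta> \<and> \<beta> < \<alpha>)"
    and major_scale: "\<exists>s rs rs'.
      is_scale (tone s, rs, rs') \<and>
      heptatonic (tone s, rs, rs') \<and>
      compatible (tone s, rs, rs') \<and>
      maximally_even (ascendent_mode (tone s, rs, rs')) \<and>
      ascendent_sensible (tone s, rs, rs') \<and>
      \<not> descendent_sensible (tone s, rs, rs') \<and>
      has_disjoint_equal_tetrachords s rs rs' \<and>
      (\<exists>x y z. major_triad (x, y, z) \<and> based_on_tonic s rs (x, y, z))"

end

theory Submission
  imports Defs "HOL-Algebra.Group"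
begin

text \<open>The logarithms of the harmonic measures greater than \<open>1\<close> form a set of positive reals that is
  closed under positive differences and bounded away from \<open>0\<close>. Such a set contains its infimum, and
  all its elements are multiples of it (\<open>ascending_measure_power\<close>). So each harmonic measure greater
  than \<open>1\<close> is \<open>\<epsilon>\<^sup>k\<close> for some \<open>k\<close>, and the claim is a question about integers: the steps of the major
  scale are \<open>\<epsilon>\<close> to the powers \<open>d\<^sub>1, \<dots>, d\<^sub>7\<close>, and their sum \<open>N\<close>, which satisfies
  \<open>\<epsilon>\<^sup>N = 2\<close>, has to be \<open>12\<close>.

  The last step is \<open>\<epsilon>\<close> (ascending sensible). Maximal evenness then leaves only the steps \<open>1\<close> and
  \<open>\<epsilon>\<close>, or \<open>\<epsilon>\<close> and \<open>\<epsilon>\<^sup>2\<close>; as the steps exceed \<open>1\<close> and the first one is not \<open>\<epsilon>\<close> (no descending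
  sensible), it is the second case, with \<open>d\<^sub>1 = 2\<close> and \<open>d\<^sub>7 = 1\<close>. Disjoint tetrachords of a
  seven-step scale can only be the two outer ones, so their equality gives \<open>d\<^sub>5 = d\<^sub>1 = 2\<close>, whence
  \<open>9 \<le> N \<le> 13\<close>. Finally the intervals of a major triad are \<open>\<epsilon>\<^sup>m\<^sup>+\<^sup>1\<close> and \<open>\<epsilon>\<^sup>m\<close> with product
  \<open>\<epsilon> \<surd>2\<close>, so \<open>\<epsilon>\<^sup>4\<^sup>m = 2\<close> and \<open>4\<close> divides \<open>N\<close>. Only \<open>N = 12\<close> remains.

  All of this presupposes the measure, whose existence is the larger part of the work
  (\<open>measure_exists\<close>). Once an origin is fixed, adding intervals makes the pitch classes a totally
  ordered group. The second half of the composition axiom says that ascending intervals commute, the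
  Dedekind axiom makes the group Archimedean, and Hoelder's theorem, proved first, embeds it into
  \<open>(\<real>, +)\<close>. The measure is \<open>2\<close> to the power of the difference of the images, normalised at an octave;
  this works for every octave because all octaves are congruent. It also yields that two
  equitonal sounds of different pitch are at least an octave apart, which keeps the inner notes of
  the scale distinct in tone from the tonic and so makes the disjointness of tetrachords
  informative.\<close>

section \<open>Archimedean ordered commutative groups\<close>

text \<open>The aim is Hoelder's theorem: an embedding of the group into the additive reals that
  preserves order. With respect to a base \<open>e\<close> above the identity, every \<open>x\<close> lies between two
  consecutive powers of \<open>e\<close>; the exponents for \<open>x\<^sup>N\<close>, divided by \<open>N\<close>, approximate the logarithm of
  \<open>x\<close>.\<close>

locale archimedean_ordered_group = comm_group G for G (structure) +
  fixes less :: "'a \<Rightarrow> 'a \<Rightarrow> bool"  (infix "\<lless>" 50)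
  assumes less_irrefl: "x \<in> carrier G \<Longrightarrow> \<not> x \<lless> x"
    and less_trans: "x \<in> carrier G \<Longrightarrow> y \<in> carrier G \<Longrightarrow> z \<in> carrier G \<Longrightarrow>
      x \<lless> y \<Longrightarrow> y \<lless> z \<Longrightarrow> x \<lless> z"
    and less_total: "x \<in> carrier G \<Longrightarrow> y \<in> carrier G \<Longrightarrow> x \<lless> y \<or> x = y \<or> y \<lless> x"
    and mult_left_mono: "x \<in> carrier G \<Longrightarrow> y \<in> carrier G \<Longrightarrow> z \<in> carrier G \<Longrightarrow>
      x \<lless> y \<Longrightarrow> z \<otimes> x \<lless> z \<otimes> y"
    and archimedean: "x \<in> carrier G \<Longrightarrow> y \<in> carrier G \<Longrightarrow> \<one> \<lless> x \<Longrightarrow> \<exists>n::nat. y \<lless> x [^] n"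
begin

lemma mult_strict_mono:
  assumes "x \<in> carrier G" "y \<in> carrier G" "u \<in> carrier G" "v \<in> carrier G" "x \<lless> y" "u \<lless> v"
  shows "x \<otimes> u \<lless> y \<otimes> v"
proof -
  have "x \<otimes> u \<lless> x \<otimes> v" using assms mult_left_mono by blast
  moreover have "x \<otimes> v \<lless> y \<otimes> v" using assms mult_left_mono[of x y v] by (simp add: m_comm)
  ultimately show ?thesis using assms less_trans by (meson m_closed)
qed

lemma mult_mono_not_less:
  assumes "x \<in> carrier G" "y \<in> carrier G" "u \<in> carrier G" "v \<in> carrier G"
    "\<not> y \<lless> x" "\<not> v \<lless> u"
  shows "\<not> y \<otimes> v \<lless> x \<otimes> u"
proof -
  have xy: "x \<lless> y \<or> x = y" and uv: "u \<lless> v \<or> u = v" using assms less_total by blast+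
  have "x \<otimes> u \<lless> y \<otimes> u" if "x \<lless> y"
    using that assms mult_left_mono[of x y u] by (simp add: m_comm)
  then have "x \<otimes> u \<lless> y \<otimes> v \<or> x \<otimes> u = y \<otimes> v"
    using xy uv mult_strict_mono[OF assms(1-4)] mult_left_mono[of u v x] assms(1-4) by blast
  moreover have "\<not> b \<lless> a" if "a \<lless> b \<or> a = b" "a \<in> carrier G" "b \<in> carrier G" for a b
    using that less_irrefl less_trans[of a b a] by blast
  ultimately show ?thesis using assms by simp
qed

lemma one_less_nat_pow:
  assumes "e \<in> carrier G" "\<one> \<lless> e" "0 < (n::nat)"
  shows "\<one> \<lless> e [^] n"
  using assms(3)
proof (induction n)
  case (Suc n)
  show ?case
  proof (cases "n = 0")
    case False
    then have "\<one> \<otimes> \<one> \<lless> e [^] n \<otimes> e" using Suc assms by (intro mult_strict_mono) auto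
    then show ?thesis by simp
  qed (use assms in simp)
qed simp

lemma int_pow_strict_mono:
  assumes "e \<in> carrier G" "\<one> \<lless> e" "i < (j::int)"
  shows "e [^] i \<lless> e [^] j"
proof -
  have "e [^] i \<otimes> \<one> \<lless> e [^] i \<otimes> e [^] nat (j - i)"
    using assms one_less_nat_pow[of e "nat (j - i)"] by (intro mult_left_mono) auto
  also have "e [^] i \<otimes> e [^] nat (j - i) = e [^] j"
    using assms by (simp add: int_pow_mult[symmetric] flip: int_pow_int)
  finally show ?thesis using assms by simp
qed

lemma int_pow_less_iff:
  assumes "e \<in> carrier G" "\<one> \<lless> e"
  shows "e [^] (i::int) \<lless> e [^] j \<longleftrightarrow> i < j"
  using assms int_pow_strict_mono less_irrefl less_trans
  by (metis int_pow_closed linorder_neqE)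

definition exponent_floor :: "'a \<Rightarrow> 'a \<Rightarrow> int" where
  "exponent_floor e x = (THE k. \<not> x \<lless> e [^] k \<and> x \<lless> e [^] (k + 1))"

lemma exponent_floor_unique:
  assumes "e \<in> carrier G" "\<one> \<lless> e" "x \<in> carrier G"
    "\<not> x \<lless> e [^] k" "x \<lless> e [^] (k + 1)" "\<not> x \<lless> e [^] l" "x \<lless> e [^] (l + 1)"
  shows "k = (l::int)"
proof -
  have "i < j + 1" if "\<not> x \<lless> e [^] i" "x \<lless> e [^] (j + 1)" for i j :: int
  proof -
    have "e [^] i \<lless> x \<or> e [^] i = x" using that assms less_total by (meson int_pow_closed)
    then have "e [^] i \<lless> e [^] (j + 1)" using that assms less_trans by (metis int_pow_closed)
    then show ?thesis using int_pow_less_iff assms by blast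
  qed
  from this[of k l] this[of l k] assms show ?thesis by force
qed

text \<open>The Archimedean property for \<open>x\<close> gives a power of \<open>e\<close> above \<open>x\<close>, and for the inverse of \<open>x\<close> one
  below \<open>x\<close>; the floor is found by searching upwards from the latter.\<close>

lemma exponent_floor_exists:
  assumes "e \<in> carrier G" "\<one> \<lless> e" "x \<in> carrier G"
  shows "\<exists>k::int. \<not> x \<lless> e [^] k \<and> x \<lless> e [^] (k + 1)"
proof -
  obtain m where m: "x \<lless> e [^] (m::nat)" using archimedean assms by blast
  obtain n where n: "inv x \<lless> e [^] (n::nat)" using archimedean assms by (meson inv_closed)
  have "x \<otimes> inv x \<lless> x \<otimes> e [^] n" using n assms by (intro mult_left_mono) auto
  then have "\<one> \<lless> x \<otimes> e [^] n" using assms by simp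
  then have "inv (e [^] n) \<otimes> \<one> \<lless> inv (e [^] n) \<otimes> (x \<otimes> e [^] n)"
    using assms by (intro mult_left_mono) auto
  then have low: "e [^] (- int n) \<lless> x"
    using assms by (simp add: int_pow_neg int_pow_int m_comm[of x] m_assoc[symmetric])
  define d where "d = (LEAST d::nat. x \<lless> e [^] (int d - int n))"
  have ex: "x \<lless> e [^] (int (m + n) - int n)" using m by (simp add: int_pow_int)
  have d: "x \<lless> e [^] (int d - int n)" unfolding d_def using ex by (rule LeastI)
  have "d \<noteq> 0"
  proof
    assume "d = 0"
    then show False using d low assms less_trans less_irrefl by (metis diff_0 int_pow_closed of_nat_0)
  qed
  then have "\<not> x \<lless> e [^] (int (d - 1) - int n)"
    using not_less_Least[of "d - 1" "\<lambda>d. x \<lless> e [^] (int d - int n)"] by (auto simp flip: d_def)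
  then have "\<not> x \<lless> e [^] (int d - 1 - int n)" using \<open>d \<noteq> 0\<close>
    by (simp add: of_nat_diff Suc_leI)
  moreover have "x \<lless> e [^] (int d - 1 - int n + 1)" using d by simp
  ultimately show ?thesis by blast
qed

lemma exponent_floor:
  assumes "e \<in> carrier G" "\<one> \<lless> e" "x \<in> carrier G"
  shows "\<not> x \<lless> e [^] exponent_floor e x" "x \<lless> e [^] (exponent_floor e x + 1)"
proof -
  have "\<exists>!k. \<not> x \<lless> e [^] (k::int) \<and> x \<lless> e [^] (k + 1)"
    using exponent_floor_exists[OF assms] exponent_floor_unique[OF assms] by blast
  from theI'[OF this] show "\<not> x \<lless> e [^] exponent_floor e x" "x \<lless> e [^] (exponent_floor e x + 1)"
    unfolding exponent_floor_def by blast+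
qed

lemma le_exponent_floor_iff:
  assumes "e \<in> carrier G" "\<one> \<lless> e" "x \<in> carrier G"
  shows "k \<le> exponent_floor e x \<longleftrightarrow> \<not> x \<lless> e [^] k"
proof
  assume "k \<le> exponent_floor e x"
  then consider "k = exponent_floor e x" | "k < exponent_floor e x" by linarith
  then show "\<not> x \<lless> e [^] k"
    using exponent_floor[OF assms] int_pow_less_iff[OF assms(1,2)] less_trans assms
    by (metis int_pow_closed)
next
  assume "\<not> x \<lless> e [^] k"
  then have "e [^] k \<lless> x \<or> e [^] k = x" using assms less_total by (meson int_pow_closed)
  then have "e [^] k \<lless> e [^] (exponent_floor e x + 1)"
    using assms less_trans exponent_floor[OF assms] by (metis int_pow_closed)
  then show "k \<le> exponent_floor e x" using int_pow_less_iff[OF assms(1,2)] by simp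
qed

text \<open>Like the floor of real numbers, the exponent is additive up to an error of \<open>1\<close>. This bounded
  error vanishes after division by \<open>N\<close>, and that makes the logarithm additive.\<close>

lemma exponent_floor_mult:
  assumes "e \<in> carrier G" "\<one> \<lless> e" "x \<in> carrier G" "y \<in> carrier G"
  shows "exponent_floor e x + exponent_floor e y \<le> exponent_floor e (x \<otimes> y)"
    and "exponent_floor e (x \<otimes> y) \<le> exponent_floor e x + exponent_floor e y + 1"
proof -
  let ?k = "exponent_floor e x" and ?l = "exponent_floor e y"
  have "\<not> x \<otimes> y \<lless> e [^] ?k \<otimes> e [^] ?l"
    using assms exponent_floor by (intro mult_mono_not_less) auto
  then show "?k + ?l \<le> exponent_floor e (x \<otimes> y)"
    using assms by (simp add: le_exponent_floor_iff int_pow_mult)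
  have "x \<otimes> y \<lless> e [^] (?k + 1) \<otimes> e [^] (?l + 1)"
    using assms exponent_floor by (intro mult_strict_mono) auto
  then have "x \<otimes> y \<lless> e [^] (?k + ?l + 2)"
    using assms by (simp add: int_pow_mult[symmetric] add.commute add.left_commute)
  then show "exponent_floor e (x \<otimes> y) \<le> ?k + ?l + 1"
    using assms le_exponent_floor_iff[of e "x \<otimes> y" "?k + ?l + 2"] by simp
qed

text \<open>Taking only the powers \<open>N = 2\<^sup>n\<close> makes the approximations increasing, so that their
  convergence needs no subadditivity argument.\<close>

definition log_approx :: "'a \<Rightarrow> 'a \<Rightarrow> nat \<Rightarrow> real" where
  "log_approx e x n = exponent_floor e (x [^] (2 ^ n :: nat)) / 2 ^ n"

definition group_log :: "'a \<Rightarrow> 'a \<Rightarrow> real" where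
  "group_log e x = lim (log_approx e x)"

lemma log_approx_Suc:
  assumes "e \<in> carrier G" "\<one> \<lless> e" "x \<in> carrier G"
  shows "log_approx e x n \<le> log_approx e x (Suc n)"
    and "log_approx e x (Suc n) \<le> log_approx e x n + 1 / 2 ^ Suc n"
proof -
  let ?y = "x [^] (2 ^ n :: nat)"
  have y: "?y \<in> carrier G" using assms by simp
  have sq: "x [^] (2 ^ Suc n :: nat) = ?y \<otimes> ?y"
    using assms by (simp add: nat_pow_mult mult_2)
  note b = exponent_floor_mult[OF assms(1,2) y y, folded sq]
  have "real_of_int (2 * exponent_floor e ?y) \<le> exponent_floor e (x [^] (2 ^ Suc n :: nat))"
    using b(1) by (subst of_int_le_iff) linarith
  then show "log_approx e x n \<le> log_approx e x (Suc n)"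
    unfolding log_approx_def by (simp add: field_simps)
  have "real_of_int (exponent_floor e (x [^] (2 ^ Suc n :: nat))) \<le> of_int (2 * exponent_floor e ?y + 1)"
    using b(2) by (subst of_int_le_iff) linarith
  then show "log_approx e x (Suc n) \<le> log_approx e x n + 1 / 2 ^ Suc n"
    unfolding log_approx_def by (simp add: field_simps)
qed

lemma log_approx_incseq:
  assumes "e \<in> carrier G" "\<one> \<lless> e" "x \<in> carrier G"
  shows "incseq (log_approx e x)"
  using log_approx_Suc(1)[OF assms] by (rule incseq_SucI)

text \<open>The increments are at most \<open>1 / 2\<^sup>n\<^sup>+\<^sup>1\<close>, hence \<open>log_approx e x n + 1 / 2\<^sup>n\<close> decreases and
  bounds the increasing sequence.\<close>

lemma log_approx_tendsto:
  assumes "e \<in> carrier G" "\<one> \<lless> e" "x \<in> carrier G"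
  shows "log_approx e x \<longlonglongrightarrow> group_log e x"
proof -
  have "log_approx e x n + 1 / 2 ^ n \<le> log_approx e x 0 + 1" for n
  proof (induction n)
    case (Suc n)
    have "(1::real) / 2 ^ Suc n + 1 / 2 ^ Suc n = 1 / 2 ^ n" by simp
    then show ?case using Suc log_approx_Suc(2)[OF assms, of n] by linarith
  qed simp
  then have "log_approx e x n \<le> log_approx e x 0 + 1" for n
    by (smt (verit) divide_nonneg_nonneg zero_le_power)
  then have "convergent (log_approx e x)"
    using incseq_convergent[OF log_approx_incseq[OF assms]] by (metis convergent_def)
  then show ?thesis unfolding group_log_def by (simp add: convergent_LIMSEQ_iff)
qed

lemma group_log_mult:
  assumes "e \<in> carrier G" "\<one> \<lless> e" "x \<in> carrier G" "y \<in> carrier G"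
  shows "group_log e (x \<otimes> y) = group_log e x + group_log e y"
proof -
  let ?d = "\<lambda>n. log_approx e (x \<otimes> y) n - (log_approx e x n + log_approx e y n)"
  have "\<bar>?d n\<bar> \<le> (1 / 2) ^ n" for n
  proof -
    let ?N = "2 ^ n :: nat"
    have p: "(x \<otimes> y) [^] ?N = x [^] ?N \<otimes> y [^] ?N" using assms by (simp add: pow_mult_distrib m_comm)
    have c: "x [^] ?N \<in> carrier G" "y [^] ?N \<in> carrier G" using assms by auto
    note b = exponent_floor_mult[OF assms(1,2) c, folded p]
    let ?E = "exponent_floor e ((x \<otimes> y) [^] ?N) - (exponent_floor e (x [^] ?N) + exponent_floor e (y [^] ?N))"
    have "?d n = real_of_int ?E / 2 ^ n" unfolding log_approx_def by (simp add: field_simps)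
    moreover have "\<bar>real_of_int ?E\<bar> \<le> 1" using b by linarith
    ultimately show ?thesis by (simp add: power_one_over divide_right_mono)
  qed
  then have "?d \<longlonglongrightarrow> 0"
    by (intro tendsto_0_le[OF LIMSEQ_power_zero[of "1/2::real"], where K = 1]) auto
  moreover have "?d \<longlonglongrightarrow> group_log e (x \<otimes> y) - (group_log e x + group_log e y)"
    using assms by (intro tendsto_intros log_approx_tendsto) auto
  ultimately show ?thesis using LIMSEQ_unique by force
qed

lemma group_log_base:
  assumes "e \<in> carrier G" "\<one> \<lless> e"
  shows "group_log e e = 1"
proof -
  have "exponent_floor e (e [^] N) = int N" for N :: nat
    using assms exponent_floor_unique[of e "e [^] N" "int N" "exponent_floor e (e [^] N)"]
      exponent_floor[of e "e [^] N"] less_irrefl int_pow_less_iff[of e "int N" "int N + 1"]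
    by (simp add: int_pow_int)
  then have "log_approx e e n = 1" for n unfolding log_approx_def by simp
  then have "log_approx e e = (\<lambda>_. 1)" by auto
  then show ?thesis using log_approx_tendsto[OF assms assms(1)] LIMSEQ_unique tendsto_const by metis
qed

text \<open>Some power \<open>x\<^sup>n\<close>, hence also \<open>x\<close> to the power \<open>2\<^sup>n \<ge> n\<close>, exceeds \<open>e\<close>; so the \<open>n\<close>-th
  approximation is already positive.\<close>

lemma group_log_pos:
  assumes "e \<in> carrier G" "\<one> \<lless> e" "x \<in> carrier G" "\<one> \<lless> x"
  shows "0 < group_log e x"
proof -
  obtain n where n: "e \<lless> x [^] (n::nat)" using archimedean assms by blast
  have "x [^] int n \<lless> x [^] int (2 ^ n)" using assms less_exp[of n]
    by (intro int_pow_strict_mono) (auto simp del: of_nat_power)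
  then have "e \<lless> x [^] (2 ^ n :: nat)" using n assms less_trans
    by (metis int_pow_int nat_pow_closed)
  then have "\<not> x [^] (2 ^ n :: nat) \<lless> e [^] (1::int)"
    using assms less_trans less_irrefl by (metis int_pow_1 nat_pow_closed)
  then have "1 \<le> exponent_floor e (x [^] (2 ^ n :: nat))"
    using assms by (simp add: le_exponent_floor_iff)
  then have "0 < log_approx e x n" unfolding log_approx_def by simp
  also have "log_approx e x n \<le> group_log e x"
    using assms by (intro incseq_le log_approx_incseq log_approx_tendsto)
  finally show ?thesis .
qed

theorem group_log_strict_mono:
  assumes "e \<in> carrier G" "\<one> \<lless> e" "x \<in> carrier G" "y \<in> carrier G" "x \<lless> y"
  shows "group_log e x < group_log e y"
proof -
  let ?q = "inv x \<otimes> y"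
  have "inv x \<otimes> x \<lless> ?q" using assms by (intro mult_left_mono) auto
  then have "0 < group_log e ?q" using assms by (intro group_log_pos) auto
  moreover have "x \<otimes> ?q = y" using assms by (simp add: m_assoc[symmetric])
  ultimately show ?thesis using group_log_mult[of e x ?q] assms by simp
qed

end

section \<open>Pitch classes form an ordered commutative group\<close>

lemma (in group) commute_with_inv:
  assumes "x \<in> carrier G" "y \<in> carrier G" "inv x \<otimes> y = y \<otimes> inv x"
  shows "x \<otimes> y = y \<otimes> x"
proof -
  have "y = x \<otimes> (y \<otimes> inv x)" using assms inv_solve_left' by auto
  then have "y = x \<otimes> y \<otimes> inv x" using assms by (simp add: m_assoc)
  then show ?thesis using assms inv_solve_right by simp
qed

(* The infix is needed for congruence of intervals. *)
no_notation iso (infixr "\<cong>" 60)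

context pitch
begin

lemma unison_refl [simp]: "x \<sim> x"
  by (simp add: unison_def lower_irrefl)

lemma pitch_cases:
  obtains "x \<prec> y" | "y \<prec> x" | "x \<sim> y"
  by (auto simp: unison_def)

lemma unison_sym: "x \<sim> y \<Longrightarrow> y \<sim> x"
  by (auto simp: unison_def)

lemma unison_trans: "x \<sim> y \<Longrightarrow> y \<sim> z \<Longrightarrow> x \<sim> z"
  using lower_no_common_unison unison_sym unison_def by meson

lemma lower_unison_trans: "x \<prec> y \<Longrightarrow> y \<sim> z \<Longrightarrow> x \<prec> z"
  using lower_no_common_unison lower_trans unison_refl unison_def by meson

lemma unison_lower_trans: "x \<sim> y \<Longrightarrow> y \<prec> z \<Longrightarrow> x \<prec> z"
  using lower_no_common_unison lower_trans unison_refl unison_sym unison_def by meson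

lemma pitch_class_eq_iff [simp]: "pitch_class x = pitch_class y \<longleftrightarrow> x \<sim> y"
  using unison_refl unison_sym unison_trans unfolding pitch_class_def by blast

lemma pitch_class_in_range [simp]: "pitch_class x \<in> range pitch_class"
  by (rule rangeI)

lemma ivl_in_intervals [simp]: "ivl a b \<in> intervals"
  unfolding intervals_def ivl_def pitch_class_def by (intro SigmaI quotientI UNIV_I)

lemma intervalsE:
  assumes "I \<in> intervals"
  obtains a b where "I = ivl a b"
  using assms by (auto simp: intervals_def ivl_def pitch_class_def elim!: quotientE)

lemma ivl_eq_iff: "ivl a b = ivl c d \<longleftrightarrow> a \<sim> c \<and> b \<sim> d"
  by (simp add: ivl_def)

lemma lower_cong: "x \<sim> x' \<Longrightarrow> y \<sim> y' \<Longrightarrow> x \<prec> y \<longleftrightarrow> x' \<prec> y'"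
  using unison_sym lower_unison_trans unison_lower_trans by meson

end

context pitch_congruence
begin

lemma ivl_congr_refl: "ivl a b \<cong> ivl a b"
  using congr_refl by (simp add: reflp_on_def)

lemma ivl_congr_trans: "ivl a b \<cong> ivl c d \<Longrightarrow> ivl c d \<cong> ivl e f \<Longrightarrow> ivl a b \<cong> ivl e f"
  using congr_trans ivl_in_intervals unfolding transp_on_def by blast

lemma ivl_congr_unison: "a \<sim> a' \<Longrightarrow> b \<sim> b' \<Longrightarrow> ivl a b \<cong> ivl a' b'"
  using ivl_congr_refl ivl_eq_iff by metis

text \<open>Transport \<open>[c, d]\<close> back to start at \<open>a\<close>: by transitivity the result is congruent to
  \<open>[a, b]\<close>, and uniqueness of transport identifies it with \<open>[a, b]\<close>.\<close>

lemma ivl_congr_sym: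
  assumes "ivl a b \<cong> ivl c d"
  shows "ivl c d \<cong> ivl a b"
proof -
  obtain b' where b': "ivl c d \<cong> ivl a b'" using congr_transport by blast
  then have "b \<sim> b'" using assms congr_transport_unique ivl_congr_refl ivl_congr_trans by meson
  then show ?thesis using b' ivl_eq_iff unison_refl by metis
qed

lemma ivl_congr_lower_iff:
  assumes "ivl a b \<cong> ivl c d"
  shows "a \<prec> b \<longleftrightarrow> c \<prec> d"
  using assms congr_lower ivl_congr_sym by blast

lemma ivl_congr_greater_iff:
  assumes "ivl a b \<cong> ivl c d"
  shows "b \<prec> a \<longleftrightarrow> d \<prec> c"
proof -
  have "d \<prec> c" if "b \<prec> a" "ivl a b \<cong> ivl c d" for a b c d
    using that congr_inverse congr_lower by blast
  then show ?thesis using assms ivl_congr_sym by blast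
qed

lemma ivl_congr_unison_iff:
  assumes "ivl a b \<cong> ivl c d"
  shows "a \<sim> b \<longleftrightarrow> c \<sim> d"
  using ivl_congr_lower_iff[OF assms] ivl_congr_greater_iff[OF assms] by (simp add: unison_def)

lemma ivl_congr_null: "ivl a a \<cong> ivl c c"
proof -
  obtain d where d: "ivl a a \<cong> ivl c d" using congr_transport by blast
  then have "c \<sim> d" using ivl_congr_unison_iff[OF d] by simp
  then show ?thesis using d ivl_eq_iff unison_refl by metis
qed

lemma ivl_congr_inverse:
  assumes "ivl a b \<cong> ivl c d"
  shows "ivl b a \<cong> ivl d c"
proof -
  consider "a \<prec> b" | "b \<prec> a" | "a \<sim> b" unfolding unison_def by blast
  then show ?thesis
  proof cases
    case 3
    then have "ivl b a = ivl a a" "ivl d c = ivl c c"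
      using assms ivl_congr_unison_iff ivl_eq_iff unison_refl unison_sym by metis+
    then show ?thesis using ivl_congr_null by simp
  qed (use assms congr_inverse in blast)+
qed

lemma ivl_congr_start_unique: "ivl x y \<cong> ivl a b \<Longrightarrow> ivl x y \<cong> ivl a' b \<Longrightarrow> a \<sim> a'"
  using ivl_congr_inverse congr_transport_unique by blast

text \<open>The composition axiom concerns ascending intervals only. Uniqueness of transport turns it
  into cancellation, and cancellation extends composition to arbitrary directions in
  \<open>ivl_congr_compose_lower\<close> and \<open>ivl_congr_compose\<close>.\<close>

lemma ivl_congr_difference_lower:
  assumes "a \<prec> c" "c \<prec> b" "ivl a b \<cong> ivl a' b'" "ivl c b \<cong> ivl c' b'"
  shows "ivl a c \<cong> ivl a' c'"
proof -
  obtain c'' where c'': "ivl a c \<cong> ivl a' c''" using congr_transport by blast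
  obtain b'' where b'': "ivl c b \<cong> ivl c'' b''" using congr_transport by blast
  have "b'' \<sim> b'"
    using congr_compose[OF assms(1,2) c'' b''] assms(3) congr_transport_unique by blast
  then have "c'' \<sim> c'"
    using b'' assms(4) ivl_congr_start_unique ivl_eq_iff unison_refl by metis
  then show ?thesis using c'' ivl_eq_iff unison_refl by metis
qed

lemma ivl_congr_compose_lower:
  assumes "a \<prec> b" "ivl a b \<cong> ivl a' b'" "ivl b c \<cong> ivl b' c'"
  shows "ivl a c \<cong> ivl a' c'"
proof -
  consider "b \<prec> c" | "b \<sim> c" | "c \<prec> b" "a \<prec> c" | "c \<prec> b" "c \<prec> a" | "c \<prec> b" "a \<sim> c"
    unfolding unison_def by blast
  then show ?thesis
  proof cases
    case 1
    then show ?thesis using assms congr_compose by blast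
  next
    case 2
    then have "b' \<sim> c'" using assms ivl_congr_unison_iff by blast
    then have "ivl a c = ivl a b" "ivl a' c' = ivl a' b'" using 2 ivl_eq_iff unison_sym unison_refl by metis+
    then show ?thesis using assms by simp
  next
    case 3
    then show ?thesis using assms ivl_congr_inverse ivl_congr_difference_lower by blast
  next
    case 4
    then show ?thesis using assms ivl_congr_inverse ivl_congr_difference_lower by blast
  next
    case 5
    then have "ivl b c = ivl b a" using ivl_eq_iff unison_sym unison_refl by metis
    then have "ivl b a \<cong> ivl b' c'" using assms by simp
    then have "a' \<sim> c'" using assms ivl_congr_inverse congr_transport_unique by blast
    then show ?thesis using 5 ivl_congr_null ivl_eq_iff unison_refl by metis
  qed
qed

theorem ivl_congr_compose:
  assumes "ivl a b \<cong> ivl a' b'" "ivl b c \<cong> ivl b' c'"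
  shows "ivl a c \<cong> ivl a' c'"
proof -
  consider "a \<prec> b" | "b \<prec> a" | "a \<sim> b" unfolding unison_def by blast
  then show ?thesis
  proof cases
    case 2
    obtain c'' where c'': "ivl a c \<cong> ivl a' c''" using congr_transport by blast
    then have "ivl b c \<cong> ivl b' c''" using 2 assms(1) ivl_congr_inverse ivl_congr_compose_lower by blast
    then have "c'' \<sim> c'" using assms(2) congr_transport_unique by blast
    then show ?thesis using c'' ivl_eq_iff unison_refl by metis
  next
    case 3
    then have "ivl a c = ivl b c" "ivl a' c' = ivl b' c'"
      using assms(1) ivl_congr_unison_iff ivl_eq_iff unison_refl by metis+
    then show ?thesis using assms(2) by simp
  qed (use assms ivl_congr_compose_lower in blast)
qed

text \<open>Relative to an origin \<open>u\<close>, a pitch class \<open>Y\<close> stands for the interval from \<open>u\<close> to \<open>Y\<close>. The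
  product of \<open>X\<close> and \<open>Y\<close> is the end of that interval when it is transported to start at \<open>X\<close>, so
  products correspond to sums of intervals.\<close>

definition pitch_mult :: "'a \<Rightarrow> 'a set \<Rightarrow> 'a set \<Rightarrow> 'a set" where
  "pitch_mult u X Y = (THE Z. Z \<in> range pitch_class \<and> (pitch_class u, Y) \<cong> (X, Z))"

definition pitch_group :: "'a \<Rightarrow> 'a set monoid" where
  "pitch_group u = \<lparr>carrier = range pitch_class, mult = pitch_mult u, one = pitch_class u\<rparr>"

definition class_lower :: "'a set \<Rightarrow> 'a set \<Rightarrow> bool" where
  "class_lower X Y \<longleftrightarrow> (\<exists>x y. X = pitch_class x \<and> Y = pitch_class y \<and> x \<prec> y)"

lemma pitch_group_simps [simp]:
  "carrier (pitch_group u) = range pitch_class"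
  "mult (pitch_group u) = pitch_mult u"
  "one (pitch_group u) = pitch_class u"
  by (simp_all add: pitch_group_def)

lemma class_lower_iff [simp]: "class_lower (pitch_class x) (pitch_class y) \<longleftrightarrow> x \<prec> y"
  unfolding class_lower_def using lower_cong unison_refl by (metis pitch_class_eq_iff)

lemma pitch_mult_eq_iff:
  "pitch_mult u (pitch_class x) (pitch_class y) = pitch_class z \<longleftrightarrow> ivl u y \<cong> ivl x z"
proof -
  obtain w where w: "ivl u y \<cong> ivl x w" using congr_transport by blast
  have "pitch_mult u (pitch_class x) (pitch_class y) = pitch_class w"
    unfolding pitch_mult_def
  proof (rule the_equality)
    show "pitch_class w \<in> range pitch_class \<and> (pitch_class u, pitch_class y) \<cong> (pitch_class x, pitch_class w)"
      using w by (simp add: ivl_def)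
  next
    fix Z assume "Z \<in> range pitch_class \<and> (pitch_class u, pitch_class y) \<cong> (pitch_class x, Z)"
    then obtain v where "Z = pitch_class v" "ivl u y \<cong> ivl x v" by (auto simp: ivl_def)
    then show "Z = pitch_class w" using w congr_transport_unique by simp
  qed
  moreover have "ivl u y \<cong> ivl x z \<longleftrightarrow> w \<sim> z"
    using w congr_transport_unique ivl_eq_iff unison_refl by metis
  ultimately show ?thesis by simp
qed

lemma pitch_multE:
  obtains z where "pitch_mult u (pitch_class x) (pitch_class y) = pitch_class z" "ivl u y \<cong> ivl x z"
  using congr_transport pitch_mult_eq_iff by metis

lemma group_pitch_group: "group (pitch_group u)"
proof (rule groupI; clarsimp)
  fix x y
  show "pitch_mult u (pitch_class x) (pitch_class y) \<in> range pitch_class"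
    by (metis pitch_multE rangeI)
next
  fix x y z
  obtain xy where xy: "pitch_mult u (pitch_class x) (pitch_class y) = pitch_class xy"
    "ivl u y \<cong> ivl x xy" by (rule pitch_multE)
  obtain yz where yz: "pitch_mult u (pitch_class y) (pitch_class z) = pitch_class yz"
    "ivl u z \<cong> ivl y yz" by (rule pitch_multE)
  obtain w where w: "pitch_mult u (pitch_class xy) (pitch_class z) = pitch_class w"
    "ivl u z \<cong> ivl xy w" by (rule pitch_multE)
  have "ivl y yz \<cong> ivl xy w" using yz(2) w(2) ivl_congr_sym ivl_congr_trans by blast
  then have "ivl u yz \<cong> ivl x w" using xy(2) ivl_congr_compose by blast
  then show "pitch_mult u (pitch_mult u (pitch_class x) (pitch_class y)) (pitch_class z) =
      pitch_mult u (pitch_class x) (pitch_mult u (pitch_class y) (pitch_class z))"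
    using xy(1) yz(1) w(1) pitch_mult_eq_iff by metis
next
  fix x
  show "pitch_mult u (pitch_class u) (pitch_class x) = pitch_class x"
    by (simp add: pitch_mult_eq_iff ivl_congr_refl)
next
  fix x
  obtain y where "ivl x u \<cong> ivl u y" using congr_transport by blast
  then have "ivl u x \<cong> ivl y u" by (rule ivl_congr_inverse)
  then show "\<exists>y. pitch_mult u (pitch_class y) (pitch_class x) = pitch_class u"
    using pitch_mult_eq_iff by blast
qed

text \<open>With \<open>xy\<close> and \<open>yx\<close> for the two products, \<open>[u, xy]\<close> consists of \<open>[u, x]\<close> followed by a copy
  of \<open>[u, y]\<close>, and \<open>[u, yx]\<close> of the same two intervals in the opposite order. The second
  composition axiom says exactly that these composites are congruent.\<close>

lemma pitch_mult_commute_above: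
  assumes "u \<prec> x" "u \<prec> y"
  shows "pitch_mult u (pitch_class x) (pitch_class y) = pitch_mult u (pitch_class y) (pitch_class x)"
proof -
  obtain xy where xy: "pitch_mult u (pitch_class x) (pitch_class y) = pitch_class xy"
    "ivl u y \<cong> ivl x xy" by (rule pitch_multE)
  obtain yx where yx: "pitch_mult u (pitch_class y) (pitch_class x) = pitch_class yx"
    "ivl u x \<cong> ivl y yx" by (rule pitch_multE)
  have "x \<prec> xy" using xy(2) assms(2) congr_lower by blast
  then have "ivl u xy \<cong> ivl u yx"
    using congr_compose_inverse[OF assms(1)] xy(2) yx(2) ivl_congr_sym by blast
  then have "xy \<sim> yx" using congr_transport_unique ivl_congr_refl by blast
  then show ?thesis using xy(1) yx(1) by simp
qed

text \<open>Products of classes above the origin commute; a class below the origin is the inverse of one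
  above it, and commuting with an inverse is commuting with the element.\<close>

lemma comm_group_pitch_group: "comm_group (pitch_group u)"
proof -
  interpret group "pitch_group u" by (rule group_pitch_group)
  have inv_above: "\<exists>x'. inv\<^bsub>pitch_group u\<^esub> (pitch_class x) = pitch_class x' \<and> u \<prec> x'" if "x \<prec> u" for x
  proof -
    obtain x' where x': "inv\<^bsub>pitch_group u\<^esub> (pitch_class x) = pitch_class x'"
      using inv_closed[of "pitch_class x"] by auto
    have "pitch_mult u (pitch_class x) (pitch_class x') = pitch_class u"
      using r_inv[of "pitch_class x"] x' by simp
    then have "ivl u x' \<cong> ivl x u" by (simp add: pitch_mult_eq_iff)
    then show ?thesis using x' that ivl_congr_lower_iff by blast
  qed
  let ?c = "\<lambda>X Y. pitch_mult u X Y = pitch_mult u Y X"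
  have above: "?c (pitch_class x) (pitch_class y)" if y: "u \<prec> y" for x y
  proof -
    consider "u \<prec> x" | "x \<prec> u" | "u \<sim> x" unfolding unison_def by blast
    then show ?thesis
    proof cases
      case 1 then show ?thesis using y pitch_mult_commute_above by blast
    next
      case 2
      then obtain x' where "inv\<^bsub>pitch_group u\<^esub> (pitch_class x) = pitch_class x'" "u \<prec> x'"
        using inv_above by blast
      then show ?thesis
        using commute_with_inv[of "pitch_class x" "pitch_class y"] y pitch_mult_commute_above by simp
    next
      case 3
      then have xu: "pitch_class x = pitch_class u" using unison_sym by simp
      show ?thesis using l_one[of "pitch_class y"] r_one[of "pitch_class y"] unfolding xu by simp
    qed
  qed
  have "?c (pitch_class x) (pitch_class y)" for x y
  proof -
    consider "u \<prec> y" | "y \<prec> u" | "u \<sim> y" unfolding unison_def by blast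
    then show ?thesis
    proof cases
      case 1 then show ?thesis by (rule above)
    next
      case 2
      then obtain y' where "inv\<^bsub>pitch_group u\<^esub> (pitch_class y) = pitch_class y'" "u \<prec> y'"
        using inv_above by blast
      then show ?thesis
        using commute_with_inv[of "pitch_class y" "pitch_class x"] above[of y' x] by simp
    next
      case 3
      then have yu: "pitch_class y = pitch_class u" using unison_sym by simp
      show ?thesis using l_one[of "pitch_class x"] r_one[of "pitch_class x"] unfolding yu by simp
    qed
  qed
  then show ?thesis by (intro group_comm_groupI) auto
qed

lemma pitch_mult_left_mono:
  assumes "x \<prec> y"
    "pitch_mult u (pitch_class z) (pitch_class x) = pitch_class s"
    "pitch_mult u (pitch_class z) (pitch_class y) = pitch_class t"
  shows "s \<prec> t"
proof -
  have "ivl x u \<cong> ivl s z" "ivl u y \<cong> ivl z t"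
    using assms pitch_mult_eq_iff ivl_congr_inverse by blast+
  then have "ivl x y \<cong> ivl s t" by (rule ivl_congr_compose)
  then show ?thesis using assms(1) congr_lower by blast
qed

text \<open>If the multiples \<open>p 0, p 1, \<dots>\<close> of an ascending interval stayed below some pitch, the sounds
  below some \<open>p n\<close> would form a proper lower cut, with a boundary \<open>\<theta>\<close> by the Dedekind axiom. One
  step down from \<open>\<theta>\<close> is inside the cut, hence \<open>\<theta>\<close> itself is below some \<open>p (n + 1)\<close>, which
  is still in the cut: a contradiction.\<close>

lemma pitch_group_archimedean:
  assumes "u \<prec> x"
  shows "\<exists>n::nat. class_lower (pitch_class y) (pitch_class x [^]\<^bsub>pitch_group u\<^esub> n)"
proof (rule ccontr)
  interpret comm_group "pitch_group u" by (rule comm_group_pitch_group)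
  assume unbounded: "\<nexists>n::nat. class_lower (pitch_class y) (pitch_class x [^]\<^bsub>pitch_group u\<^esub> n)"
  obtain p where p: "pitch_class x [^]\<^bsub>pitch_group u\<^esub> n = pitch_class (p n)" for n :: nat
  proof -
    have "\<forall>n::nat. \<exists>s. pitch_class x [^]\<^bsub>pitch_group u\<^esub> n = pitch_class s"
      using nat_pow_closed[of "pitch_class x"] by (auto simp del: pitch_class_eq_iff)
    then show ?thesis using that by metis
  qed
  have step: "ivl u x \<cong> ivl (p n) (p (Suc n))" for n
    using nat_pow_Suc[of "pitch_class x" n] unfolding p pitch_group_simps
    by (metis pitch_mult_eq_iff)
  have p_less: "p n \<prec> p (Suc n)" for n using step assms congr_lower by blast
  define P where "P = {s. \<exists>n. s \<prec> p n}"
  have "\<exists>\<theta>. (\<forall>s. s \<prec> \<theta> \<longrightarrow> s \<in> P) \<and> (\<forall>s. \<theta> \<prec> s \<longrightarrow> s \<in> - P)"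
  proof (rule dedekind)
    show "P \<noteq> {}" using lower_unbounded unfolding P_def by blast
    have "\<not> y \<prec> p n" for n using unbounded by (simp add: p)
    then show "- P \<noteq> {}" unfolding P_def by blast
    show "\<forall>q\<in>- P. \<forall>p\<in>P. \<not> q \<prec> p" unfolding P_def using lower_trans by blast
  qed auto
  then obtain \<theta> where \<theta>: "\<And>s. s \<prec> \<theta> \<Longrightarrow> s \<in> P" "\<And>s. \<theta> \<prec> s \<Longrightarrow> s \<notin> P" by blast
  obtain t where "ivl x u \<cong> ivl \<theta> t" using congr_transport by blast
  then have t: "ivl u x \<cong> ivl t \<theta>" by (rule ivl_congr_inverse)
  then have "t \<prec> \<theta>" using assms congr_lower by blast
  then obtain n where n: "t \<prec> p n" using \<theta>(1) unfolding P_def by blast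
  have "pitch_mult u (pitch_class x) (pitch_class t) = pitch_class \<theta>"
    "pitch_mult u (pitch_class x) (pitch_class (p n)) = pitch_class (p (Suc n))"
    using t step[of n] m_comm[of "pitch_class x"] by (simp_all add: pitch_mult_eq_iff)
  then have "\<theta> \<prec> p (Suc n)" using n pitch_mult_left_mono by blast
  moreover have "p (Suc n) \<in> P" using p_less unfolding P_def by blast
  ultimately show False using \<theta>(2) by blast
qed

theorem archimedean_pitch_group: "archimedean_ordered_group (pitch_group u) class_lower"
proof -
  interpret comm_group "pitch_group u" by (rule comm_group_pitch_group)
  show ?thesis
  proof (unfold_locales, goal_cases)
    case (1 x)
    then show ?case using lower_irrefl by auto
  next
    case (2 x y z)
    then show ?case using lower_trans by auto
  next
    case (3 x y)
    then obtain a b where ab: "x = pitch_class a" "y = pitch_class b" by auto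
    then show ?case by (cases rule: pitch_cases[of a b]) simp_all
  next
    case (4 x y z)
    then obtain a b c where abc: "x = pitch_class a" "y = pitch_class b" "z = pitch_class c"
      by auto
    then have "a \<prec> b" using 4 by simp
    obtain s where "pitch_mult u (pitch_class c) (pitch_class a) = pitch_class s" by (rule pitch_multE)
    moreover obtain t where "pitch_mult u (pitch_class c) (pitch_class b) = pitch_class t" by (rule pitch_multE)
    ultimately show ?case using abc pitch_mult_left_mono[OF \<open>a \<prec> b\<close>] by simp
  next
    case (5 x y)
    then show ?case using pitch_group_archimedean by auto
  qed
qed

text \<open>Hoelder's embedding with base \<open>v\<close>. Differences of its values are invariant under transport,
  so they no longer depend on the origin of the group structure, and they form an additive measure
  of intervals in which \<open>[u, v]\<close> is the unit.\<close>

theorem interval_log_exists: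
  assumes "u \<prec> v"
  obtains h where "h (pitch_class v) - h (pitch_class u) = (1::real)"
    "\<And>x y. h (pitch_class x) < h (pitch_class y) \<longleftrightarrow> x \<prec> y"
    "\<And>a b c d. h (pitch_class b) - h (pitch_class a) = h (pitch_class d) - h (pitch_class c) \<longleftrightarrow> ivl a b \<cong> ivl c d"
proof -
  interpret archimedean_ordered_group "pitch_group u" class_lower by (rule archimedean_pitch_group)
  define h where "h = group_log (pitch_class v)"
  have v: "pitch_class v \<in> carrier (pitch_group u)" "class_lower \<one>\<^bsub>pitch_group u\<^esub> (pitch_class v)"
    using assms by auto
  have add: "h (pitch_class z) = h (pitch_class x) + h (pitch_class y)" if "ivl u y \<cong> ivl x z" for x y z
    using group_log_mult[OF v, of "pitch_class x" "pitch_class y"] that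
    by (simp add: h_def flip: pitch_mult_eq_iff)
  have mono: "h (pitch_class x) < h (pitch_class y)" if "x \<prec> y" for x y
    using group_log_strict_mono[OF v] that by (simp add: h_def)
  have eq: "h (pitch_class x) = h (pitch_class y)" if "x \<sim> y" for x y
    using that pitch_class_eq_iff by metis
  have lt_iff: "h (pitch_class x) < h (pitch_class y) \<longleftrightarrow> x \<prec> y" for x y
    using mono[of x y] mono[of y x] eq[of x y] by (cases rule: pitch_cases[of x y]) auto
  have eq_iff: "h (pitch_class x) = h (pitch_class y) \<longleftrightarrow> x \<sim> y" for x y
    using lt_iff[of x y] lt_iff[of y x] by (auto simp: unison_def)
  have diff: "h (pitch_class b) - h (pitch_class a) = h (pitch_class d) - h (pitch_class c) \<longleftrightarrow> ivl a b \<cong> ivl c d"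
    for a b c d
  proof -
    obtain x where x: "ivl a b \<cong> ivl u x" using congr_transport by blast
    obtain y where y: "ivl c d \<cong> ivl u y" using congr_transport by blast
    have "h (pitch_class b) - h (pitch_class a) = h (pitch_class x)"
      "h (pitch_class d) - h (pitch_class c) = h (pitch_class y)"
      using add x y ivl_congr_sym by fastforce+
    moreover have "ivl a b \<cong> ivl c d \<longleftrightarrow> ivl u x \<cong> ivl u y"
      using x y ivl_congr_sym ivl_congr_trans by blast
    moreover have "ivl u x \<cong> ivl u y \<longleftrightarrow> x \<sim> y"
      using congr_transport_unique[OF ivl_congr_refl] ivl_congr_unison[OF unison_refl] by blast
    ultimately show ?thesis using eq_iff by simp
  qed
  have "h (pitch_class u) = 0" using add[of u u u] ivl_congr_refl by simp
  moreover have "h (pitch_class v) = 1" using group_log_base[OF v] by (simp add: h_def)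
  ultimately show thesis using that[of h] lt_iff diff by simp
qed

end

section \<open>Existence of the measure\<close>

context tonality
begin

lemma equitonal_refl: "x \<simeq> x"
  by (simp add: unison_equitonal)

lemma equitonal_sym: "x \<simeq> y \<Longrightarrow> y \<simeq> x"
  using equitonal_euclid equitonal_refl by blast

lemma equitonal_trans: "x \<simeq> y \<Longrightarrow> y \<simeq> z \<Longrightarrow> x \<simeq> z"
  using equitonal_euclid equitonal_sym by blast

lemma tone_eq_iff: "tone x = tone y \<longleftrightarrow> x \<simeq> y"
  unfolding tone_def using equitonal_refl equitonal_sym equitonal_trans by blast

text \<open>An octave interval determines its end points only up to unison, so this says that being an
  octave above is invariant under unison; it makes the congruence axiom for octaves usable.\<close>

lemma is_octave_above_iff_octave: "is_octave_above s t \<longleftrightarrow> ivl s t \<in> octaves"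
proof
  assume "ivl s t \<in> octaves"
  then obtain s' t' where st: "s \<sim> s'" "t \<sim> t'" and o: "is_octave_above s' t'"
    by (auto simp: octaves_def ivl_eq_iff)
  have s: "s \<simeq> s'" and t: "t \<simeq> t'" using st unison_equitonal by auto
  have t': "t' \<simeq> s'" "s' \<prec> t'" and least: "\<And>x. x \<simeq> s' \<Longrightarrow> s' \<prec> x \<Longrightarrow> \<not> x \<prec> t'"
    using o by (auto simp: is_octave_above_def)
  have "t \<simeq> s" using equitonal_trans[OF t] equitonal_trans[OF t'(1)] equitonal_sym[OF s] by blast
  moreover have "s \<prec> t" using t'(2) lower_cong[OF st] by simp
  moreover have "\<not> x \<prec> t" if "x \<simeq> s" "s \<prec> x" for x
    using least[of x] that equitonal_trans[OF _ s] lower_cong[OF st(1) unison_refl]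
      lower_cong[OF unison_refl st(2)] by blast
  ultimately show "is_octave_above s t" by (simp add: is_octave_above_def)
qed (auto simp: octaves_def)

lemma is_octave_above_unique: "is_octave_above s t \<Longrightarrow> is_octave_above s t' \<Longrightarrow> t \<sim> t'"
  by (auto simp: is_octave_above_def unison_def)

text \<open>Transport any octave interval to start at \<open>s\<close>; the result is again an octave.\<close>

lemma octave_above_exists:
  obtains t where "is_octave_above s t"
proof -
  obtain s0 t0 where o: "ivl s0 t0 \<in> octaves" using octave_exists by (auto simp: octaves_def)
  obtain t where "ivl s0 t0 \<cong> ivl s t" using congr_transport by blast
  then have "ivl s t \<in> octaves" using o octave_congr ivl_congr_sym ivl_in_intervals by blast
  then show thesis using that is_octave_above_iff_octave by blast
qed

text \<open>The copy of \<open>[s, t]\<close> at \<open>s'\<close> is an octave, and the octave above \<open>s'\<close> is unique up to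
  unison.\<close>

lemma octaves_congruent:
  assumes "is_octave_above s t" "is_octave_above s' t'"
  shows "ivl s t \<cong> ivl s' t'"
proof -
  obtain t'' where t'': "ivl s t \<cong> ivl s' t''" using congr_transport by blast
  then have "ivl s' t'' \<in> octaves"
    using assms(1) octave_congr ivl_congr_sym ivl_in_intervals is_octave_above_iff_octave by blast
  then have "t'' \<sim> t'" using assms(2) is_octave_above_iff_octave is_octave_above_unique by blast
  then show ?thesis using t'' ivl_eq_iff unison_refl by metis
qed

theorem measure_exists: "\<exists>\<mu>. is_measure \<mu>"
proof -
  obtain u v where uv: "is_octave_above u v" using octave_above_exists by blast
  then have "u \<prec> v" by (simp add: is_octave_above_def)
  then obtain h where h: "h (pitch_class v) - h (pitch_class u) = (1::real)"
    "\<And>x y. h (pitch_class x) < h (pitch_class y) \<longleftrightarrow> x \<prec> y"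
    "\<And>a b c d. h (pitch_class b) - h (pitch_class a) = h (pitch_class d) - h (pitch_class c) \<longleftrightarrow>
      ivl a b \<cong> ivl c d"
    using interval_log_exists by blast
  define \<mu> where "\<mu> I = 2 powr (h (snd I) - h (fst I))" for I
  have \<mu>: "\<mu> (ivl a b) = 2 powr (h (pitch_class b) - h (pitch_class a))" for a b
    by (simp add: \<mu>_def ivl_def)
  have oct: "\<mu> I = 2" if I: "I \<in> octaves" for I
  proof -
    obtain s t where st: "I = ivl s t" "is_octave_above s t"
      using I unfolding octaves_def by blast
    then have "h (pitch_class t) - h (pitch_class s) = 1"
      using octaves_congruent[OF uv] h(1,3) by metis
    then show ?thesis using st(1) by (simp add: \<mu>)
  qed
  have powr_1: "1 < (2::real) powr x \<longleftrightarrow> 0 < x" "(2::real) powr x < 1 \<longleftrightarrow> x < 0"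
    "(2::real) powr x = 1 \<longleftrightarrow> x = 0" for x
    using powr_less_cancel_iff[of 2 0 x] powr_less_cancel_iff[of 2 x 0] powr_inj[of 2 x 0] by simp_all
  have h_eq: "h (pitch_class a) = h (pitch_class b) \<longleftrightarrow> a \<sim> b" for a b
    using h(2)[of a b] h(2)[of b a] by (auto simp: unison_def)
  have "is_measure \<mu>"
    unfolding is_measure_def
  proof (intro conjI ballI allI)
    show "0 < \<mu> I" for I by (simp add: \<mu>_def)
    show "\<mu> I = 2" if "I \<in> octaves" for I using that by (rule oct)
    show "1 < \<mu> (ivl a b) \<longleftrightarrow> a \<prec> b" "\<mu> (ivl a b) < 1 \<longleftrightarrow> b \<prec> a" for a b
      using h(2) by (simp_all add: \<mu> powr_1)
    show "\<mu> (ivl a b) = 1 \<longleftrightarrow> a \<sim> b" for a b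
      using h_eq[of a b] by (auto simp: \<mu> powr_1)
    show "\<mu> (ivl a b) = \<mu> (ivl c d) \<longleftrightarrow> ivl a b \<cong> ivl c d" for a b c d
      by (simp add: \<mu> powr_inj h(3))
    show "\<mu> (ivl a c) = \<mu> (ivl a b) * \<mu> (ivl b c)" for a b c
      by (simp add: \<mu> flip: powr_add)
  qed
  then show ?thesis by blast
qed

lemma is_measure_msr: "is_measure msr"
  unfolding msr_def using measure_exists by (rule someI_ex)

lemma msr_pos: "I \<in> intervals \<Longrightarrow> 0 < msr I"
  and msr_octave: "is_octave_above s t \<Longrightarrow> msr (ivl s t) = 2"
  and msr_gt_1_iff: "1 < msr (ivl a b) \<longleftrightarrow> a \<prec> b"
  and msr_eq_1_iff: "msr (ivl a b) = 1 \<longleftrightarrow> a \<sim> b"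
  and msr_eq_iff: "msr (ivl a b) = msr (ivl c d) \<longleftrightarrow> ivl a b \<cong> ivl c d"
  and msr_compose: "msr (ivl a c) = msr (ivl a b) * msr (ivl b c)"
  using is_measure_msr unfolding is_measure_def by (blast intro: iffD1[OF is_octave_above_iff_octave])+

lemma msr_inverse: "msr (ivl b a) = inverse (msr (ivl a b))"
proof -
  have "msr (ivl a b) * msr (ivl b a) = 1" using msr_compose[of a a b] msr_eq_1_iff[of a a] by simp
  then show ?thesis by (metis inverse_unique)
qed

lemma equitonal_above_msr_ge_2:
  assumes "x \<simeq> s" "s \<prec> x"
  shows "2 \<le> msr (ivl s x)"
proof -
  obtain t where t: "is_octave_above s t" using octave_above_exists by blast
  then have "\<not> x \<prec> t" using assms by (simp add: is_octave_above_def)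
  then have "1 \<le> msr (ivl t x)" using msr_gt_1_iff[of t x] msr_eq_1_iff[of t x] by (auto simp: unison_def)
  then show ?thesis using msr_compose[of s x t] msr_octave[OF t] by simp
qed

end

section \<open>Harmonic measures are powers of the smallest one\<close>

text \<open>If the infimum were not attained, two distinct elements of \<open>S\<close> would lie so close to it that
  their ratio, an element of \<open>S\<close>, fell below \<open>\<alpha>\<close>.\<close>

lemma discrete_ratios_Inf_mem:
  fixes S :: "real set"
  assumes "S \<noteq> {}" "\<alpha> > 1" "\<And>r. r \<in> S \<Longrightarrow> \<alpha> \<le> r"
    and ratio: "\<And>r s. r \<in> S \<Longrightarrow> s \<in> S \<Longrightarrow> s < r \<Longrightarrow> r / s \<in> S"
  shows "Inf S \<in> S"
proof (rule ccontr)
  assume notin: "Inf S \<notin> S"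
  have lower: "Inf S \<le> r" if "r \<in> S" for r
    using that assms(3) by (intro cInf_lower bdd_belowI)
  have "\<alpha> \<le> Inf S" using assms(1,3) by (intro cInf_greatest)
  then have "Inf S < Inf S * \<alpha>" using assms(2) by simp
  then obtain r where r: "r \<in> S" "r < Inf S * \<alpha>" using cInf_lessD[OF assms(1)] by blast
  then have "Inf S < r" using lower notin by (metis order_le_less)
  then obtain s where s: "s \<in> S" "s < r" using cInf_lessD[OF assms(1)] by blast
  have "0 < s" "0 < \<alpha>" using assms(2,3) s(1) by fastforce+
  have "r < s * \<alpha>" using r(2) lower[OF s(1)] \<open>0 < \<alpha>\<close> by (smt (verit) mult_right_mono)
  then have "r / s < \<alpha>" using \<open>0 < s\<close> by (simp add: field_simps)
  then show False using assms(3) ratio r(1) s by fastforce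
qed

text \<open>Divide by the infimum as long as the quotient is above it; each quotient is in \<open>S\<close>, and the
  process stops at the infimum itself.\<close>

lemma discrete_ratios_power:
  fixes S :: "real set"
  assumes "1 < Inf S" "Inf S \<in> S" "\<And>r. r \<in> S \<Longrightarrow> Inf S \<le> r"
    and ratio: "\<And>r s. r \<in> S \<Longrightarrow> s \<in> S \<Longrightarrow> s < r \<Longrightarrow> r / s \<in> S"
    and "r \<in> S"
  shows "\<exists>k. r = Inf S ^ k"
proof -
  have "\<exists>k. r = Inf S ^ k" if "r < Inf S ^ n" "r \<in> S" for n r
    using that
  proof (induction n arbitrary: r)
    case 0
    then show ?case using assms(1) assms(3)[of r] by simp
  next
    case (Suc n)
    show ?case
    proof (cases "r = Inf S")
      case True
      then show ?thesis by (metis power_one_right)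
    next
      case False
      then have "r / Inf S \<in> S" using Suc.prems(2) assms(2,3) ratio by force
      moreover have "r / Inf S < Inf S ^ n" using Suc.prems(1) assms(1) by (simp add: field_simps)
      ultimately obtain k where "r / Inf S = Inf S ^ k" using Suc.IH by blast
      then have "r = Inf S ^ Suc k" using assms(1) by (simp add: field_simps)
      then show ?thesis by blast
    qed
  qed
  then show ?thesis using real_arch_pow[OF assms(1)] assms(5) by blast
qed

context harmony
begin

lemma harmonic_measuresE:
  assumes "r \<in> harmonic_measures"
  obtains a b where "ivl a b \<in> harmonic" "r = msr (ivl a b)"
  using assms harmonic_subset intervalsE unfolding harmonic_measures_def by (smt (verit) imageE subsetD)

lemma harmonic_measures_pos: "r \<in> harmonic_measures \<Longrightarrow> 0 < r"
  using harmonic_measuresE msr_pos ivl_in_intervals by metis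

lemma harmonic_measures_inverse:
  assumes "r \<in> harmonic_measures" "r \<noteq> 1"
  shows "inverse r \<in> harmonic_measures"
proof -
  obtain a b where "ivl a b \<in> harmonic" "r = msr (ivl a b)" using assms(1) by (rule harmonic_measuresE)
  then show ?thesis
    using assms(2) harmonic_inverse msr_eq_1_iff msr_inverse unfolding harmonic_measures_def
    by (metis image_eqI)
qed

lemma interval_of_harmonic_measure:
  assumes "r \<in> harmonic_measures"
  shows "\<exists>x. msr (ivl a x) = r"
proof -
  obtain c d where "r = msr (ivl c d)" using assms by (rule harmonic_measuresE)
  moreover obtain x where "ivl c d \<cong> ivl a x" using congr_transport by blast
  ultimately show ?thesis using msr_eq_iff by metis
qed

abbreviation ascending_measures :: "real set" where
  "ascending_measures \<equiv> {r \<in> harmonic_measures. r > 1}"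

lemma ascending_measures_ratio:
  assumes "r \<in> ascending_measures" "s \<in> ascending_measures" "s < r"
  shows "r / s \<in> ascending_measures"
proof -
  have "r * inverse s \<in> harmonic_measures"
    using assms harmonic_measures_inverse by (intro harmonic_mult) auto
  then show ?thesis using assms by (simp add: field_simps)
qed

lemma ascending_measures_nonempty: "ascending_measures \<noteq> {}"
proof -
  obtain s rs rs' where "is_scale (tone s, rs, rs')" "heptatonic (tone s, rs, rs')"
    using major_scale by blast
  then have "rs ! 0 \<in> ascending_measures" by (simp add: is_scale_def heptatonic_def)
  then show ?thesis by blast
qed

lemma epsilon_mem: "epsilon \<in> ascending_measures"
proof -
  obtain \<alpha> where "\<alpha> > 1" "\<And>r. r \<in> ascending_measures \<Longrightarrow> \<alpha> \<le> r"
    using harmonic_gap by (metis (no_types, lifting) mem_Collect_eq not_le)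
  then show ?thesis
    unfolding epsilon_def
    using ascending_measures_nonempty ascending_measures_ratio by (intro discrete_ratios_Inf_mem)
qed

lemma epsilon_gt_1: "1 < epsilon"
  using epsilon_mem by simp

lemma ascending_measure_power:
  assumes "r \<in> harmonic_measures" "1 < r"
  shows "\<exists>k. r = epsilon ^ k"
  unfolding epsilon_def
proof (rule discrete_ratios_power[of ascending_measures])
  show "Inf ascending_measures \<le> r" if "r \<in> ascending_measures" for r
    using that by (intro cInf_lower bdd_belowI[of _ 1]) auto
qed (use assms epsilon_mem epsilon_gt_1 ascending_measures_ratio in \<open>simp_all add: epsilon_def\<close>)

section \<open>The major scale\<close>

text \<open>A step by a harmonic measure is possible from every sound, by transport of an interval with
  that measure; hence the choice in \<open>scale_note\<close> always succeeds.\<close>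

lemma msr_scale_note:
  assumes "set qs \<subseteq> harmonic_measures" "i \<le> length qs"
  shows "msr (ivl s (scale_note s qs i)) = prod_list (take i qs)"
  using assms(2)
proof (induction i)
  case 0
  show ?case using msr_eq_1_iff by simp
next
  case (Suc i)
  have "qs ! i \<in> harmonic_measures" using Suc.prems assms(1) by (auto simp: subset_iff)
  then have "msr (ivl (scale_note s qs i) (scale_note s qs (Suc i))) = qs ! i"
    using someI_ex[OF interval_of_harmonic_measure] by simp
  then show ?case
    using Suc msr_compose[of s "scale_note s qs (Suc i)" "scale_note s qs i"]
    by (simp add: take_Suc_conv_app_nth del: scale_note.simps)
qed

lemma prod_list_gt_1:
  fixes qs :: "real list"
  assumes "qs \<noteq> []" "\<forall>q\<in>set qs. 1 < q"
  shows "1 < prod_list qs"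
  using assms
proof (induction qs)
  case (Cons q qs)
  then show ?case by (cases "qs = []") (auto intro: less_1_mult)
qed simp

lemma prod_list_take_bounds:
  fixes qs :: "real list"
  assumes "\<forall>q\<in>set qs. 1 < q" "0 < i" "i < length qs"
  shows "1 < prod_list (take i qs)" "prod_list (take i qs) < prod_list qs"
proof -
  have "\<forall>q\<in>set (take i qs). 1 < q" "\<forall>q\<in>set (drop i qs). 1 < q"
    using assms(1) set_take_subset[of i qs] set_drop_subset[of i qs] by blast+
  then have p: "1 < prod_list (take i qs)" and q: "1 < prod_list (drop i qs)"
    using assms(2,3) by (auto intro!: prod_list_gt_1)
  show "1 < prod_list (take i qs)" by (rule p)
  have "prod_list (take i qs) * 1 < prod_list (take i qs) * prod_list (drop i qs)"
    using p q by (intro mult_strict_left_mono) auto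
  then show "prod_list (take i qs) < prod_list qs" by (simp flip: prod_list.append)
qed

lemma equitonal_msr_not_between:
  assumes "x \<simeq> s" "1 < msr (ivl s x)"
  shows "\<not> msr (ivl s x) < 2"
  using assms equitonal_above_msr_ge_2 msr_gt_1_iff by (simp add: not_less)

text \<open>An inner note is above the tonic by less than an octave, whereas an equitonal sound above the
  tonic is at least an octave away.\<close>

lemma inner_note_not_tonic_ascending:
  assumes "set qs \<subseteq> harmonic_measures" "\<forall>q\<in>set qs. 1 < q" "prod_list qs = 2" "0 < i" "i < length qs"
  shows "tone (scale_note s qs i) \<noteq> tone s"
  using assms prod_list_take_bounds[of qs i] equitonal_msr_not_between[of "scale_note s qs i" s]
  by (auto simp: tone_eq_iff msr_scale_note)

lemma prod_list_inverse: "prod_list (map inverse qs) = inverse (prod_list (qs :: real list))"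
  by (induction qs) auto

text \<open>As in the ascending case, seen from the note: the tonic is above it by less than an octave.\<close>

lemma inner_note_not_tonic_descending:
  assumes "set qs \<subseteq> harmonic_measures" "\<forall>q\<in>set qs. q < 1" "prod_list qs = 1 / 2" "0 < i" "i < length qs"
  shows "tone (scale_note s qs i) \<noteq> tone s"
proof
  assume "tone (scale_note s qs i) = tone s"
  then have eq: "s \<simeq> scale_note s qs i" by (simp add: tone_eq_iff equitonal_sym)
  have "msr (ivl (scale_note s qs i) s) = inverse (prod_list (take i qs))"
    using assms msr_scale_note[of qs i s] msr_inverse[of "scale_note s qs i" s] by simp
  also have "\<dots> = prod_list (take i (map inverse qs))" by (simp add: prod_list_inverse take_map)
  finally have m: "msr (ivl (scale_note s qs i) s) = prod_list (take i (map inverse qs))" .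
  have "\<forall>q\<in>set (map inverse qs). 1 < q"
    using assms(1,2) harmonic_measures_pos one_less_inverse by auto
  from prod_list_take_bounds[OF this assms(4)] show False
    using equitonal_msr_not_between[OF eq] m assms(3,5) by (simp add: prod_list_inverse)
qed

text \<open>The tetrachords around steps \<open>k < l\<close> share the note \<open>k + 1\<close> unless \<open>l \<ge> k + 4\<close>, and that note
  is inner, hence not in the tone of the tonic. Of the middle steps \<open>2, \<dots>, 6\<close> only \<open>2\<close> and \<open>6\<close> are
  that far apart. The first and third components of the resulting equation are recorded because
  reversal, which turns ascending steps into descending ones, swaps their roles.\<close>

lemma disjoint_tetrachords:
  assumes len: "length qs = 7"
    and inner: "\<And>i. 0 < i \<Longrightarrow> i < 7 \<Longrightarrow> tone (scale_note s qs i) \<noteq> tone s"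
    and TU: "T \<in> tetrachords s qs" "U \<in> tetrachords s qs" "T \<noteq> U" "fst T = fst U"
      "snd T \<inter> snd U \<subseteq> {tone s}"
  shows "qs ! 0 = qs ! 4 \<and> qs ! 2 = qs ! 6"
proof -
  define trio where "trio k = (qs ! (k - 2), qs ! (k - 1), qs ! k)" for k
  define comps where "comps k = {tone (scale_note s qs i) |i. k - 2 \<le> i \<and> i \<le> k + 1}" for k
  have mem: "\<exists>k. V = (trio k, comps k) \<and> 1 < k \<and> k < 7" if "V \<in> tetrachords s qs" for V
    using that unfolding tetrachords_def trio_def comps_def len by (auto simp: numeral_2_eq_2)
  obtain k l where k: "T = (trio k, comps k)" "1 < k" "k < 7" and l: "U = (trio l, comps l)" "1 < l" "l < 7"
    using mem TU(1,2) by meson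
  have far: "k = 2 \<and> l = 6" if "k < l" "l < 7" "1 < k" "comps k \<inter> comps l \<subseteq> {tone s}" for k l
  proof (rule ccontr)
    assume "\<not> (k = 2 \<and> l = 6)"
    then have "l - 2 \<le> k + 1" using that by auto
    then have "tone (scale_note s qs (k + 1)) \<in> comps k \<inter> comps l"
      using that(1) unfolding comps_def
      by (auto simp del: scale_note.simps intro!: exI[of _ "Suc k"])
    then show False using that inner[of "k + 1"] by auto
  qed
  have "k \<noteq> l" using TU(3) k(1) l(1) by auto
  then have "k = 2 \<and> l = 6 \<or> l = 2 \<and> k = 6"
    using far[of k l] far[of l k] k l TU(5) by (simp add: Int_commute) linarith
  moreover have "trio k = trio l" using TU(4) k(1) l(1) by simp
  ultimately show ?thesis by (auto simp: trio_def)
qed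

lemma tetrachord_first_mem:
  assumes "T \<in> tetrachords s qs"
  shows "fst (fst T) \<in> set qs"
  using assms unfolding tetrachords_def by auto

theorem epsilon_power_12: "epsilon ^ 12 = 2"
proof -
  obtain s rs rs' where scale: "is_scale (tone s, rs, rs')" and hepta: "heptatonic (tone s, rs, rs')"
    and compat: "compatible (tone s, rs, rs')"
    and even: "maximally_even (ascendent_mode (tone s, rs, rs'))"
    and up: "ascendent_sensible (tone s, rs, rs')" and down: "\<not> descendent_sensible (tone s, rs, rs')"
    and tetra: "has_disjoint_equal_tetrachords s rs rs'"
    and triad: "\<exists>x y z. major_triad (x, y, z)"
    using major_scale by blast
  have rs: "set rs \<subseteq> harmonic_measures" "\<forall>r\<in>set rs. 1 < r" "prod_list rs = 2" "length rs = 7"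
    and rs': "set rs' \<subseteq> harmonic_measures" "\<forall>r\<in>set rs'. r < 1" "prod_list rs' = 1 / 2" "length rs' = 7"
    using scale hepta by (auto simp: is_scale_def heptatonic_def)
  have rs'_nth: "rs' ! i = inverse (rs ! (6 - i))" if "i < 7" for i
  proof -
    have "\<forall>j\<in>{1..7}. rs' ! (j - 1) = inverse (rs ! (7 - j + 1 - 1))"
      using compat rs'(4) by (simp add: compatible_def)
    then have "rs' ! (Suc i - 1) = inverse (rs ! (7 - Suc i + 1 - 1))"
      using that by (intro bspec[where x = "Suc i"]) auto
    then show ?thesis by simp
  qed
  have "rs \<noteq> []" "rs' \<noteq> []" using rs(4) rs'(4) by auto
  (* Lists count from 0: the seventh step is rs ! 6, and the last descending step inverts rs ! 0. *)
  have last: "rs ! 6 = epsilon" using up rs(4) \<open>rs \<noteq> []\<close> by (simp add: ascendent_sensible_def last_conv_nth)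
  have first: "rs ! 0 \<noteq> epsilon"
    using down rs'_nth[of 6] rs'(4) \<open>rs' \<noteq> []\<close> by (simp add: descendent_sensible_def last_conv_nth)

  obtain k where k: "set rs \<subseteq> {epsilon powi k, epsilon powi (k + 1)}"
    using even by (auto simp: maximally_even_def ascendent_mode_def)
  have powi_inj: "epsilon powi i = epsilon powi j \<Longrightarrow> i = j" for i j
    using epsilon_gt_1 power_int_strict_increasing[of i j epsilon] power_int_strict_increasing[of j i epsilon]
    by (cases i j rule: linorder_cases) auto
  have "epsilon \<in> set rs" using last rs(4) by (metis lessI nth_mem numeral_nat(7) eval_nat_numeral(3))
  then have "epsilon powi 1 = epsilon powi k \<or> epsilon powi 1 = epsilon powi (k + 1)" using k by auto
  then have "1 = k \<or> 1 = k + 1" using powi_inj by blast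
  then have "k = 1 \<or> k = 0" by auto
  moreover have "k \<noteq> 0"
  proof
    assume "k = 0"
    then have "set rs \<subseteq> {1, epsilon}" using k by simp
    moreover have "rs ! 0 \<in> set rs" using rs(4) by simp
    ultimately show False using first rs(2) by fastforce
  qed
  ultimately have steps: "set rs \<subseteq> {epsilon ^ 1, epsilon ^ 2}" using k by simp
  have "\<forall>i<7. \<exists>d. rs ! i = epsilon ^ d \<and> 1 \<le> d \<and> d \<le> 2"
  proof (intro allI impI)
    fix i :: nat assume "i < 7"
    then have "rs ! i \<in> set rs" using rs(4) by simp
    then consider "rs ! i = epsilon ^ 1" | "rs ! i = epsilon ^ 2" using steps by blast
    then show "\<exists>d. rs ! i = epsilon ^ d \<and> 1 \<le> d \<and> d \<le> 2" by cases (auto intro: exI[of _ 1] exI[of _ 2])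
  qed
  then obtain d where d: "\<And>i. i < 7 \<Longrightarrow> rs ! i = epsilon ^ d i" "\<And>i. i < 7 \<Longrightarrow> 1 \<le> d i" "\<And>i. i < 7 \<Longrightarrow> d i \<le> 2"
    by metis
  have pow_inj: "epsilon ^ i = epsilon ^ j \<longleftrightarrow> i = j" for i j
    using epsilon_gt_1 by simp
  have d6: "d 6 = 1" using d(1)[of 6] last pow_inj[of "d 6" 1] by simp
  have "d 0 \<noteq> 1" using d(1)[of 0] first by auto
  then have d0: "d 0 = 2" using d(2,3)[of 0] by simp
  have d4: "d 4 = 2"
  proof -
    obtain T U where TU: "T \<in> tetrachords s rs \<union> tetrachords s rs'" "U \<in> tetrachords s rs \<union> tetrachords s rs'"
      "T \<noteq> U" "fst T = fst U" "snd T \<inter> snd U \<subseteq> {tone s}"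
      using tetra unfolding has_disjoint_equal_tetrachords_def by blast
    (* Ascending steps exceed 1 and descending ones do not, so equal tetrachords have one direction. *)
    have mixed: False if "V \<in> tetrachords s rs" "W \<in> tetrachords s rs'" "fst V = fst W" for V W
      using that tetrachord_first_mem rs(2) rs'(2) by (metis less_asym)
    have inner: "tone (scale_note s rs i) \<noteq> tone s" "tone (scale_note s rs' i) \<noteq> tone s" if "0 < i" "i < 7" for i
      using that rs rs' inner_note_not_tonic_ascending inner_note_not_tonic_descending by auto
    consider "T \<in> tetrachords s rs" "U \<in> tetrachords s rs" | "T \<in> tetrachords s rs'" "U \<in> tetrachords s rs'"
      using TU(1,2,4) mixed[of T U] mixed[of U T] by auto
    then have "rs ! 0 = rs ! 4"
    proof cases
      case 1
      then show ?thesis using disjoint_tetrachords[OF rs(4) inner(1)] TU by blast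
    next
      case 2
      (* Reversal maps the third and seventh descending steps to the fifth and first ascending ones. *)
      then have "rs' ! 2 = rs' ! 6" using disjoint_tetrachords[OF rs'(4) inner(2)] TU by blast
      then show ?thesis using rs'_nth[of 2] rs'_nth[of 6] by simp
    qed
    then show ?thesis using d(1)[of 0] d(1)[of 4] d0 pow_inj by simp
  qed
  have "rs = map (\<lambda>i. epsilon ^ d i) [0..<7]" using d(1) rs(4) by (intro nth_equalityI) auto
  then have two: "epsilon ^ (\<Sum>i<7. d i) = 2"
    using rs(3) by (simp add: eval_nat_numeral power_add mult.assoc)
  obtain x y z where xyz: "y \<prec> z" "ivl y z \<in> harmonic" "msr (ivl x y) = epsilon * msr (ivl y z)"
    "msr (ivl x z) = epsilon * 2 powr (1 / 2)"
    using triad by (auto simp: major_triad_def is_triad_def)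
  obtain m where m: "msr (ivl y z) = epsilon ^ m"
    using ascending_measure_power[of "msr (ivl y z)"] xyz(1,2) msr_gt_1_iff
    by (auto simp: harmonic_measures_def)
  (* The outer interval of the triad has measure epsilon * sqrt 2, its two parts epsilon^(m+1), epsilon^m. *)
  have "epsilon * (epsilon ^ m) ^ 2 = epsilon * sqrt 2"
    using msr_compose[of x z y] xyz m by (auto simp: power2_eq_square powr_half_sqrt)
  then have "((epsilon ^ m) ^ 2) ^ 2 = 2" using epsilon_gt_1 by simp
  then have "epsilon ^ (4 * m) = 2" by (simp add: mult.commute flip: power_mult)
  then have sum: "(\<Sum>i<7. d i) = 4 * m" using two pow_inj by metis
  have "(\<Sum>i<7. d i) = d 0 + d 1 + d 2 + d 3 + d 4 + d 5 + d 6"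
    by (simp add: eval_nat_numeral)
  (* The sum is at least 2 + 1 + 1 + 1 + 2 + 1 + 1 = 9 and at most 13, and a multiple of 4. *)
  then have "4 * m = 12"
    using sum d0 d4 d6 d(2,3)[of 1] d(2,3)[of 2] d(2,3)[of 3] d(2,3)[of 5] by presburger
  then show ?thesis using \<open>epsilon ^ (4 * m) = 2\<close> by simp
qed

end

theorem theorem5p81:
  fixes lower :: "'a \<Rightarrow> 'a \<Rightarrow> bool"
    and congr :: "'a set \<times> 'a set \<Rightarrow> 'a set \<times> 'a set \<Rightarrow> bool"
    and equitonal :: "'a \<Rightarrow> 'a \<Rightarrow> bool"
    and harmonic :: "('a set \<times> 'a set) set"
  assumes "harmony lower congr equitonal harmonic"
  shows "{r \<in> harmonic_intervals.harmonic_measures lower congr equitonal harmonic. r > 1} \<noteq> {} \<and>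
    bdd_below {r \<in> harmonic_intervals.harmonic_measures lower congr equitonal harmonic. r > 1} \<and>
    harmonic_intervals.epsilon lower congr equitonal harmonic = 2 powr (1 / 12)"
proof -
  interpret harmony lower congr equitonal harmonic by (rule assms)
  have "epsilon powr real 12 = 2"
    using epsilon_gt_1 epsilon_power_12 by (subst powr_realpow) auto
  then have "2 powr (1 / 12) = (epsilon powr 12) powr (1 / 12)" by simp
  also have "\<dots> = epsilon" using epsilon_gt_1 by (simp only: powr_powr) simp
  finally have "epsilon = 2 powr (1 / 12)" by simp
  moreover have "bdd_below ascending_measures" by (intro bdd_belowI[of _ 1]) auto
  ultimately show ?thesis using ascending_measures_nonempty by blast
qed

end
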